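(* Let $p,q\in\mathbb{Z}$, and let $(u_r)_{r\ge 0}$ be defined by $u_0=0$, $u_1=1$, $u_r=pu_{r-1}-qu_{r-2}$ for $r\ge 2$. Then for every integer $n\ge 1$ and every integer $i$ with $0\le i\le n+1$, the generalised binomial coefficient $(n+1|i)_u$ is an integer: $(n+1|i)_u\in\mathbb{Z}$.
   Context: Generalised binomial coefficients $(r|k)_u$: let $\sigma,\tau\in\mathbb{C}$ be the roots (with multiplicity) of $x^2-px+q=0$. For $r\ge 1$ let $f_r(x,y)=\sum_{i=0}^{r-1}x^{r-1-i}y^i=(x^r-y^r)/(x-y)\in\mathbb{Z}[x,y]$. For $1\le k\le r$ the quotient $$F(r,k,x,y)=\frac{f_rf_{r-1}\cdots f_{r-k+1}}{f_kf_{k-1}\cdots f_1}$$ is a polynomial in $\mathbb{Z}[x,y]$. Define $(r|k)_u=F(r,k,\sigma,\tau)$ for $1\le k\le r$, and $(r|0)_u=1$. One has $u_r=f_r(\sigma,\tau)$ for $r\ge 1$; no assumption is made that the $u_r$ are nonzero. *)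

theory Defs
  imports Complex_Main "HOL-Computational_Algebra.Computational_Algebra"
begin

text \<open>
  \<open>\<int>[x, y]\<close> is rendered as \<open>(\<int>[x])[y]\<close>: in \<^typ>\<open>int poly poly\<close> the indeterminate of the
  coefficient ring is \<open>x\<close>, that of the outer ring is \<open>y\<close>.
\<close>

definition var_x :: "int poly poly" where
  "var_x = [:[:0, 1:]:]"

definition var_y :: "int poly poly" where
  "var_y = [:0, 1:]"

definition eval_xy :: "int poly poly \<Rightarrow> complex \<Rightarrow> complex \<Rightarrow> complex" where
  "eval_xy P a b = poly (map_poly (\<lambda>c. poly (map_poly of_int c) a) P) b"

definition f_poly :: "nat \<Rightarrow> int poly poly" where
  "f_poly r = (\<Sum>i<r. var_x ^ (r - 1 - i) * var_y ^ i)"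

text \<open>
  The division below is division in \<open>\<int>[x, y]\<close>; for \<open>k \<le> r\<close> it is exact, see
  \<open>F_poly_mult\<close>.
\<close>

definition F_poly :: "nat \<Rightarrow> nat \<Rightarrow> int poly poly" where
  "F_poly r k = (\<Prod>j<k. f_poly (r - j)) div (\<Prod>j=1..k. f_poly j)"

text \<open>
  \<open>gen_binom \<sigma> \<tau> r k\<close> is \<open>(r|k)\<^sub>u\<close> for the sequence \<open>u\<close> whose characteristic polynomial
  \<open>x\<^sup>2 - p x + q\<close> has the roots \<open>\<sigma>, \<tau>\<close>. It is only meaningful for \<open>k \<le> r\<close>.
\<close>

definition gen_binom :: "complex \<Rightarrow> complex \<Rightarrow> nat \<Rightarrow> nat \<Rightarrow> complex" where
  "gen_binom \<sigma> \<tau> r k = (if k = 0 then 1 else eval_xy (F_poly r k) \<sigma> \<tau>)"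

lemma f_poly_Suc: "f_poly (Suc r) = var_x * f_poly r + var_y ^ r"
proof -
  have "(\<Sum>i<r. var_x ^ (r - i) * var_y ^ i) = var_x * f_poly r"
    unfolding f_poly_def sum_distrib_left
  proof (rule sum.cong)
    fix i assume "i \<in> {..<r}"
    then have "r - i = Suc (r - 1 - i)" by auto
    then show "var_x ^ (r - i) * var_y ^ i = var_x * (var_x ^ (r - 1 - i) * var_y ^ i)"
      by (simp add: mult.assoc)
  qed simp
  then show ?thesis by (simp add: f_poly_def)
qed

lemma f_poly_0 [simp]: "f_poly 0 = 0"
  by (simp add: f_poly_def)

lemma f_poly_add: "f_poly (a + b) = var_x ^ b * f_poly a + var_y ^ a * f_poly b"
  by (induction b) (simp_all add: f_poly_Suc power_add algebra_simps)

lemma f_poly_mult_diff: "(var_x - var_y) * f_poly r = var_x ^ r - var_y ^ r"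
proof (induction r)
  case (Suc r)
  have "(var_x - var_y) * f_poly (Suc r) =
      var_x * ((var_x - var_y) * f_poly r) + (var_x - var_y) * var_y ^ r"
    by (simp add: f_poly_Suc algebra_simps)
  also have "\<dots> = var_x ^ Suc r - var_y ^ Suc r"
    unfolding Suc.IH by (simp add: algebra_simps)
  finally show ?case .
qed simp

lemma f_poly_nonzero: "r \<ge> 1 \<Longrightarrow> f_poly r \<noteq> 0"
proof
  assume "r \<ge> 1" "f_poly r = 0"
  then have "var_x ^ r = var_y ^ r" using f_poly_mult_diff[of r] by simp
  moreover have "poly (var_x ^ r) 0 \<noteq> poly (var_y ^ r) 0"
    using \<open>r \<ge> 1\<close> by (simp add: var_x_def var_y_def poly_power power_0_left)
  ultimately show False by simp
qed

lemma F_poly_exact: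
  assumes "k \<le> r"
  shows "(\<Prod>j=1..k. f_poly j) dvd (\<Prod>j<k. f_poly (r - j))"
  using assms
proof (induction r arbitrary: k)
  case 0
  then show ?case by simp
next
  case (Suc r)
  show ?case
  proof (cases k)
    case 0
    then show ?thesis by simp
  next
    case [simp]: (Suc l)
    have lr: "l \<le> r" using Suc.prems by simp
    define N where "N = (\<Prod>j<l. f_poly (r - j))"
    define D where "D = (\<Prod>j=1..l. f_poly j)"
    have num: "(\<Prod>j<k. f_poly (Suc r - j)) = f_poly (Suc r) * N"
      unfolding N_def Suc prod.lessThan_Suc_shift by simp
    have den: "(\<Prod>j=1..k. f_poly j) = D * f_poly (Suc l)"
      unfolding D_def Suc by simp
    have 1: "D dvd N" unfolding D_def N_def using Suc.IH[OF lr] .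
    have 2: "D * f_poly (Suc l) dvd N * f_poly (r - l)"
    proof (cases "l = r")
      case False
      then have "Suc l \<le> r" using lr by simp
      from Suc.IH[OF this] show ?thesis unfolding D_def N_def by simp
    qed simp
    have "f_poly (Suc r) = var_x ^ (r - l) * f_poly (Suc l) + var_y ^ Suc l * f_poly (r - l)"
      using f_poly_add[of "Suc l" "r - l"] lr by simp
    then have "f_poly (Suc r) * N =
        var_x ^ (r - l) * (N * f_poly (Suc l)) + var_y ^ Suc l * (N * f_poly (r - l))"
      by (simp only: algebra_simps)
    moreover have "D * f_poly (Suc l) dvd N * f_poly (Suc l)"
      using 1 by (simp add: mult_dvd_mono)
    ultimately have "D * f_poly (Suc l) dvd f_poly (Suc r) * N"
      using 2 by (simp only: dvd_add dvd_mult)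
    then show ?thesis by (simp only: num den)
  qed
qed

lemma F_poly_mult:
  assumes "k \<le> r"
  shows "F_poly r k * (\<Prod>j=1..k. f_poly j) = (\<Prod>j<k. f_poly (r - j))"
  using F_poly_exact[OF assms] by (simp only: F_poly_def dvd_div_mult_self)

lemma coeff_eval_add:
  "poly (map_poly of_int (c + d)) (a::complex) =
     poly (map_poly of_int c) a + poly (map_poly of_int d) a"
proof -
  have "map_poly of_int (c + d) = map_poly of_int c + (map_poly of_int d :: complex poly)"
    by (rule poly_eqI) (simp add: coeff_map_poly)
  then show ?thesis by simp
qed

lemma eval_xy_0 [simp]: "eval_xy 0 a b = 0"
  by (simp add: eval_xy_def)

lemma eval_xy_pCons:
  "eval_xy (pCons c P) a b = poly (map_poly of_int c) a + b * eval_xy P a b"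
  by (simp add: eval_xy_def map_poly_pCons)

lemma eval_xy_1 [simp]: "eval_xy 1 a b = 1"
  unfolding one_pCons by (simp add: eval_xy_pCons map_poly_pCons)

lemma eval_xy_add: "eval_xy (P + Q) a b = eval_xy P a b + eval_xy Q a b"
  by (induction P Q rule: poly_induct2) (simp_all add: eval_xy_pCons coeff_eval_add algebra_simps)

lemma eval_xy_var_y_mult: "eval_xy (var_y * P) a b = b * eval_xy P a b"
  by (simp add: var_y_def eval_xy_pCons)

lemma eval_xy_var_x_mult: "eval_xy (var_x * P) a b = a * eval_xy P a b"
  by (induction P) (simp_all add: var_x_def eval_xy_pCons map_poly_pCons algebra_simps)

lemma eval_xy_var_y_power: "eval_xy (var_y ^ r) a b = b ^ r"
  by (induction r) (simp_all add: eval_xy_var_y_mult)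

lemma eval_f_poly_Suc: "eval_xy (f_poly (Suc r)) a b = a * eval_xy (f_poly r) a b + b ^ r"
  by (simp add: f_poly_Suc eval_xy_add eval_xy_var_x_mult eval_xy_var_y_power)

lemma lucas_eq_eval_f_poly:
  fixes u :: "nat \<Rightarrow> int"
  assumes "u 0 = 0" "u 1 = 1"
    and rec: "\<And>r. r \<ge> 2 \<Longrightarrow> u r = p * u (r - 1) - q * u (r - 2)"
    and roots: "[:of_int q, - of_int p, 1:] = [:- \<sigma>, 1:] * [:- \<tau>, 1:]"
  shows "of_int (u r) = eval_xy (f_poly r) \<sigma> \<tau>"
proof (induction r rule: less_induct)
  case (less r)
  have p: "of_int p = \<sigma> + \<tau>" and q: "of_int q = \<sigma> * \<tau>"
    using roots by (auto simp: algebra_simps minus_equation_iff)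
  consider "r = 0" | "r = 1" | s where "r = Suc (Suc s)"
    by (metis One_nat_def not0_implies_Suc)
  then show ?case
  proof cases
    case 3
    have "u r = p * u (Suc s) - q * u s" using rec[of r] 3 by simp
    then have "complex_of_int (u r) = of_int p * of_int (u (Suc s)) - of_int q * of_int (u s)"
      by simp
    also have "\<dots> = eval_xy (f_poly r) \<sigma> \<tau>"
      using less[of s] less[of "Suc s"] 3
      by (simp add: p q eval_f_poly_Suc algebra_simps)
    finally show ?thesis .
  qed (use assms in \<open>simp_all add: eval_f_poly_Suc\<close>)
qed

end

theory Submission
  imports Defs
begin

text \<open>
  The polynomials \<open>f\<^sub>r\<close> satisfy, like the Lucas numbers, the addition formula
  \<open>f\<^sub>a\<^sub>+\<^sub>m\<^sub>+\<^sub>1 = f\<^sub>a\<^sub>+\<^sub>1 f\<^sub>m\<^sub>+\<^sub>1 - x y f\<^sub>a f\<^sub>m\<close> (lemma \<open>f_poly_add_symmetric\<close>). Its coefficients involve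
  only \<open>f\<close> and the product \<open>x y\<close>, both symmetric in \<open>x\<close> and \<open>y\<close>. Multiplied by the quotient of
  \<open>f\<close>-factorials, it becomes a Pascal rule for the polynomials \<open>F\<close> with the same property
  (\<open>F_poly_Pascal\<close>). At \<open>(\<sigma>, \<tau>)\<close> these coefficients take the values \<open>u\<^sub>r\<close> and \<open>\<sigma> \<tau> = q\<close>, which are
  integers, so integrality follows by induction along the Pascal triangle
  (\<open>eval_F_poly_in_Ints\<close>). The rule is derived in \<open>\<int>[x, y]\<close>, where the \<open>f\<^sub>r\<close> with \<open>r \<ge> 1\<close> can be
  cancelled, and evaluated only afterwards; this is why zeros of \<open>u\<close> do no harm.
\<close>

lemma f_poly_Suc': "f_poly (Suc r) = var_y * f_poly r + var_x ^ r"
  using f_poly_add[of 1 r] by (simp add: f_poly_def)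

text \<open>
  The powers of the single variables in \<open>f_poly_add\<close> are not symmetric, so their values at
  \<open>(\<sigma>, \<tau>)\<close> need not be integers. They are eliminated here by solving the two recursions for
  \<open>f_poly (Suc r)\<close>, in which the roles of \<open>x\<close> and \<open>y\<close> are exchanged, for the power.
\<close>

lemma f_poly_add_symmetric:
  "f_poly (a + Suc m) = f_poly (Suc a) * f_poly (Suc m) - var_x * (var_y * (f_poly a * f_poly m))"
proof -
  have x: "var_x ^ m = f_poly (Suc m) - var_y * f_poly m"
    by (simp add: f_poly_Suc')
  have y: "var_y ^ a = f_poly (Suc a) - var_x * f_poly a"
    by (simp add: f_poly_Suc)
  have "f_poly (a + Suc m) = var_x * var_x ^ m * f_poly a + var_y ^ a * f_poly (Suc m)"
    by (simp only: f_poly_add power_Suc)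
  then show ?thesis
    unfolding x y by (simp add: algebra_simps)
qed

lemma prod_f_poly_nonzero: "(\<Prod>j=1..k. f_poly j) \<noteq> 0"
  by (simp add: f_poly_nonzero)

lemma F_poly_0 [simp]: "F_poly r 0 = 1"
  by (simp add: F_poly_def)

lemma F_poly_self [simp]: "F_poly r r = 1"
proof -
  have "(\<Prod>j<r. f_poly (r - j)) = (\<Prod>j=1..r. f_poly j)"
    by (rule prod.reindex_bij_witness[of _ "\<lambda>j. r - j" "\<lambda>j. r - j"]) auto
  then show ?thesis
    unfolding F_poly_def using prod_f_poly_nonzero[of r] by simp
qed

text \<open>
  The addition formula for \<open>Suc r = Suc l + (r - l)\<close>, multiplied by
  \<open>f\<^sub>r \<cdots> f\<^sub>r\<^sub>-\<^sub>l\<^sub>+\<^sub>1\<close> and divided by \<open>f\<^sub>1 \<cdots> f\<^sub>l\<^sub>+\<^sub>1\<close>. The diagonal \<open>l = r\<close> is excluded because the formula splits off a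
  positive second summand.
\<close>

lemma F_poly_Pascal:
  assumes "l < r"
  shows "F_poly (Suc r) (Suc l) =
    f_poly (l + 2) * F_poly r (Suc l) - var_x * (var_y * (f_poly (r - Suc l) * F_poly r l))"
proof -
  define m where "m = r - Suc l"
  have r: "r = l + Suc m" using assms by (simp add: m_def)
  define D where "D = (\<Prod>j=1..l. f_poly j)"
  define N where "N = (\<Prod>j<l. f_poly (r - j))"
  have D': "(\<Prod>j=1..Suc l. f_poly j) = D * f_poly (Suc l)"
    by (simp add: D_def)
  have F: "F_poly r l * D = N"
    unfolding D_def N_def using assms by (intro F_poly_mult) simp
  have F1: "F_poly r (Suc l) * (D * f_poly (Suc l)) = N * f_poly (Suc m)"
    using F_poly_mult[of "Suc l" r] assms unfolding D' by (simp add: N_def r)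
  have "F_poly (Suc r) (Suc l) * (D * f_poly (Suc l)) = (\<Prod>j<Suc l. f_poly (Suc r - j))"
    using F_poly_mult[of "Suc l" "Suc r"] assms unfolding D' by simp
  also have "\<dots> = f_poly (Suc l + Suc m) * N"
    unfolding N_def prod.lessThan_Suc_shift by (simp add: r)
  also have "\<dots> = f_poly (l + 2) * (N * f_poly (Suc m)) -
      var_x * (var_y * (f_poly m * (N * f_poly (Suc l))))"
    unfolding f_poly_add_symmetric by (simp add: algebra_simps)
  also have "\<dots> = (f_poly (l + 2) * F_poly r (Suc l) -
      var_x * (var_y * (f_poly m * F_poly r l))) * (D * f_poly (Suc l))"
    unfolding F1[symmetric] unfolding F[symmetric] by (simp only: algebra_simps)
  finally show ?thesis
    using prod_f_poly_nonzero[of "Suc l"] unfolding D' m_def mult_cancel_right by blast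
qed

lemma eval_xy_minus: "eval_xy (- P) a b = - eval_xy P a b"
  using eval_xy_add[of P "- P" a b] by (simp add: eq_neg_iff_add_eq_0 add.commute)

lemma eval_xy_diff: "eval_xy (P - Q) a b = eval_xy P a b - eval_xy Q a b"
  using eval_xy_add[of P "- Q" a b] by (simp add: eval_xy_minus)

lemma eval_xy_var_y_power_mult: "eval_xy (var_y ^ r * P) a b = b ^ r * eval_xy P a b"
  by (induction r) (simp_all add: mult.assoc eval_xy_var_y_mult)

lemma eval_xy_f_poly_mult: "eval_xy (f_poly r * P) a b = eval_xy (f_poly r) a b * eval_xy P a b"
  by (induction r)
    (simp_all add: f_poly_Suc distrib_right mult.assoc eval_xy_add eval_xy_var_x_mult
      eval_xy_var_y_power_mult eval_xy_var_y_power)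

lemma eval_F_poly_in_Ints:
  assumes prod_int: "a * b \<in> \<int>"
    and f_int: "\<And>m. eval_xy (f_poly m) a b \<in> \<int>"
    and "k \<le> r"
  shows "eval_xy (F_poly r k) a b \<in> \<int>"
  using \<open>k \<le> r\<close>
proof (induction r arbitrary: k)
  case 0
  then show ?case by simp
next
  case (Suc r)
  consider "k = 0" | "k = Suc r" | l where "k = Suc l" "l < r"
    using Suc.prems by (cases k) (auto simp: le_less)
  then show ?case
  proof cases
    case 3
    then have "eval_xy (F_poly (Suc r) k) a b =
        eval_xy (f_poly (l + 2)) a b * eval_xy (F_poly r (Suc l)) a b -
        (a * b) * (eval_xy (f_poly (r - Suc l)) a b * eval_xy (F_poly r l) a b)"
      by (simp only: F_poly_Pascal eval_xy_diff eval_xy_var_x_mult eval_xy_var_y_mult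
          eval_xy_f_poly_mult mult.assoc)
    moreover have "eval_xy (F_poly r (Suc l)) a b \<in> \<int>" "eval_xy (F_poly r l) a b \<in> \<int>"
      using 3 by (auto intro: Suc.IH)
    ultimately show ?thesis
      using prod_int f_int by (simp only: Ints_diff Ints_mult)
  qed simp_all
qed

theorem propositionA2:
  fixes p q :: int and u :: "nat \<Rightarrow> int" and \<sigma> \<tau> :: complex and n i :: nat
  assumes u0: "u 0 = 0"
    and u1: "u 1 = 1"
    and u_rec: "\<And>r. r \<ge> 2 \<Longrightarrow> u r = p * u (r - 1) - q * u (r - 2)"
    and roots: "[:of_int q, - of_int p, 1:] = [:- \<sigma>, 1:] * [:- \<tau>, 1:]"
    and n: "n \<ge> 1"
    and i: "i \<le> n + 1"
  shows "gen_binom \<sigma> \<tau> (n + 1) i \<in> \<int>"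
proof -
  have "\<sigma> * \<tau> = of_int q"
    using roots by simp
  then have "\<sigma> * \<tau> \<in> \<int>" by simp
  moreover have "eval_xy (f_poly m) \<sigma> \<tau> \<in> \<int>" for m
    using lucas_eq_eval_f_poly[OF u0 u1 u_rec roots, of m] by (metis Ints_of_int)
  ultimately have "eval_xy (F_poly (n + 1) i) \<sigma> \<tau> \<in> \<int>"
    using i by (rule eval_F_poly_in_Ints)
  then show ?thesis by (simp add: gen_binom_def)
qed

end
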